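(* Any solution for Safe Finite Exploration under the TRAN model cannot achieve a reliable port marking, even assuming that agents and nodes have unique IDs and infinite memory, that the scheduler is fully synchronous (FSYNCH), and that the agents know $k$, $|V|$ and $|B|$. That is, there is no deterministic algorithm that both solves Safe Finite Exploration and achieves a reliable port marking on every instance consisting of a temporally connected dangerous network $\mathcal G=(G=(V,E),\varrho,\Lambda,B)$ of the TRAN model and a team of $k\ge 2\eta'+\sum_{b\in B}\delta(b)+1$ agents arranged on its safe nodes, where $\eta'$ is the number of transient edges of $\mathcal G$ that are not dangerous; this holds even if agents and nodes have unique IDs and infinite memory, the scheduler is fully synchronous (FSYNCH), and the agents know $k$, $|V|$ and $|B|$.
   Context: **Network.** A network is $\mathcal G=(G,\varrho,\Lambda,B)$, where $G=(V,E)$ is a finite simple undirected graph; $\varrho:E\times\mathbb N_0\to\{0,1\}$ says whether edge $e$ is present ($1$) or absent ($0$) at time $t$; $B\subsetneq V$ is the (possibly empty) set of black holes, the nodes of $V\setminus B$ being called safe. No edge joins two black holes. Each node $v$ of degree $\delta(v)$ has, for each incident edge $\{v,w\}\in E$, a port $p_{v,w}$ (there whether or not the edge is currently present); $\Lambda$ consists of bijections $\lambda_v$ from the ports of $v$ to $\{0,\dots,\delta(v)-1\}$, which are fixed, arbitrary and visible only at $v$. Each port has an ingoing and an outgoing sub-port. An edge is recurrent if for every $t$ it is present at some $t'>t$, and transient otherwise. A journey is a sequence $((e_1,t_1),\dots,(e_m,t_m))$ with $(e_1,\dots,e_m)$ a walk in $G$, $t_1<\dots<t_m$ and $\varrho(e_i,t_i)=1$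 for all $i$. Networks are always assumed temporally connected: for all $v,w\in V$ and all $t$ there is a journey from $v$ to $w$ starting at a time $\ge t$ containing no black hole except possibly its endpoints $v,w$. The TRAN model consists of all such networks (transient edges allowed). An edge $\{v,w\}$ and its ports are safe if $v,w$ are both safe, and dangerous otherwise. **Agents.** $k$ agents, initially at the centers of arbitrary safe nodes (several may share a node), all run the same deterministic algorithm. Each node $v$ has a whiteboard (persistent local memory, accessed in mutual exclusion) and each agent has a persistent notebook. An agent sees only its own node: its position in the node (center or a sub-port), the port labels, the whiteboard, and how many agents are at the center and on each sub-port; it does not see whether incident edges are present. An agent entering a black hole is trapped there forever; otherwise it is free. Time proceeds in rounds $t=0,1,2,\dots$. In each round the activated agents, one after another in some order chosen by the scheduler, read the whiteboard and their notebook, compute, possibly rewrite whiteboard and notebook, and possibly move to the center or to an outgoing sub-port of the current node; then, simultaneously, each activated agent on the outgoing sub-port of $p_{v,w}$ with $\varrho(\{v,w\},t)=1$ crosses the edge and arrives at the ingoing sub-port of $p_{w,v}$ at $w$. Under FSYNCH all agents are activated in every round. A node is visited at time $t$ if some agent is in it (center or sub-port) at time $t$. **Safe Finite Exploration.** The agents must reach, in finite time, a configuration in which at least one agent is free; every safe node has previously been visited at least once; each free agent is at the center of a node (not necessarily the same one); and every agent does nothing at all later times. **Reliable port marking.** Ports may be marked SAFE or DANGEROUS on the whiteboard of their node (some may be unmarked). Let $\mathcal G_{\mathrm{SAFE}}$ be the network obtained from $\mathcal G$ by removing all black holes and all edges with at least one port not marked SAFE. A reliable port marking is achieved if at some finite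 time: at least one agent is free; all dangerous ports at safe nodes are marked DANGEROUS; $\mathcal G_{\mathrm{SAFE}}$ is temporally connected (for every ordered pair of its nodes and every time $t$ there is a journey in $\mathcal G_{\mathrm{SAFE}}$ from the first to the second starting at a time $\ge t$); and the marks never change afterwards. *)

theory Defs
  imports Main
begin

text \<open>Edges are two-element sets of nodes. The port \<open>p\<^sub>v\<^sub>,\<^sub>w\<close> is the pair of \<open>v\<close> and its neighbour
  \<open>w\<close>; its label is \<open>port N v w\<close>. The values of \<open>present\<close> outside \<open>edges\<close> are irrelevant.\<close>

record 'v network =
  nodes :: "'v set"
  edges :: "'v set set"
  present :: "'v set \<Rightarrow> nat \<Rightarrow> bool"
  port :: "'v \<Rightarrow> 'v \<Rightarrow> nat"
  holes :: "'v set"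

definition neighbours :: "'v network \<Rightarrow> 'v \<Rightarrow> 'v set" where
  "neighbours N v = {w. {v, w} \<in> edges N}"

definition degree :: "'v network \<Rightarrow> 'v \<Rightarrow> nat" where
  "degree N v = card (neighbours N v)"

definition safe_nodes :: "'v network \<Rightarrow> 'v set" where
  "safe_nodes N = nodes N - holes N"

definition recurrent :: "'v network \<Rightarrow> 'v set \<Rightarrow> bool" where
  "recurrent N e \<longleftrightarrow> (\<forall>t. \<exists>t'>t. present N e t')"

abbreviation transient :: "'v network \<Rightarrow> 'v set \<Rightarrow> bool" where
  "transient N e \<equiv> \<not> recurrent N e"

definition dangerous_edge :: "'v network \<Rightarrow> 'v set \<Rightarrow> bool" where
  "dangerous_edge N e \<longleftrightarrow> \<not> e \<subseteq> safe_nodes N"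

text \<open>\<open>journey E pr xs js\<close>: the timed edges \<open>js\<close> form a journey traversing the nodes \<open>xs\<close> in
  this order. The empty journey (\<open>js = []\<close>, one node) is allowed.\<close>

definition journey ::
    "'v set set \<Rightarrow> ('v set \<Rightarrow> nat \<Rightarrow> bool) \<Rightarrow> 'v list \<Rightarrow> ('v set \<times> nat) list \<Rightarrow> bool" where
  "journey E pr xs js \<longleftrightarrow>
     length xs = Suc (length js) \<and>
     (\<forall>i<length js. fst (js ! i) = {xs ! i, xs ! Suc i}) \<and>
     (\<forall>(e, t)\<in>set js. e \<in> E \<and> pr e t) \<and>
     sorted_wrt (<) (map snd js)"

definition temporally_connected ::
    "'v set \<Rightarrow> 'v set set \<Rightarrow> ('v set \<Rightarrow> nat \<Rightarrow> bool) \<Rightarrow> 'v set \<Rightarrow> bool" where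
  "temporally_connected V E pr B \<longleftrightarrow>
     (\<forall>v\<in>V. \<forall>w\<in>V. \<forall>t. \<exists>xs js. journey E pr xs js \<and> hd xs = v \<and> last xs = w \<and>
        (\<forall>(e, s)\<in>set js. t \<le> s) \<and> set xs \<inter> B \<subseteq> {v, w})"

definition TRAN_network :: "'v network \<Rightarrow> bool" where
  "TRAN_network N \<longleftrightarrow>
     finite (nodes N) \<and>
     edges N \<subseteq> {e. e \<subseteq> nodes N \<and> card e = 2} \<and>
     (\<forall>v\<in>nodes N. bij_betw (port N v) (neighbours N v) {..<degree N v}) \<and>
     holes N \<subset> nodes N \<and>
     (\<forall>e\<in>edges N. \<not> e \<subseteq> holes N) \<and>
     temporally_connected (nodes N) (edges N) (present N) (holes N)"

text \<open>Sub-ports are identified by the label of their port.\<close>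

datatype position = Center | Ingoing nat | Outgoing nat

datatype move = Stay | To_Center | To_Outgoing nat

datatype mark = SAFE | DANGEROUS

text \<open>A whiteboard holds the marks of the ports of its node, indexed by label (\<open>None\<close>: unmarked),
  and further memory of an arbitrary type \<open>'w\<close>.\<close>

record 'w whiteboard =
  marks :: "nat \<Rightarrow> mark option"
  memory :: 'w

text \<open>Everything an agent can base its behaviour on. The labels of the ports of the current node
  are the numbers below \<open>view_degree\<close>; \<open>view_crowd\<close> counts the agents, including the agent itself,
  in each position of the current node.\<close>

record ('w, 'm) view =
  view_team_size :: nat
  view_num_nodes :: nat
  view_num_holes :: nat
  view_agent_id :: nat
  view_node_id :: nat
  view_degree :: nat
  view_position :: position
  view_crowd :: "position \<Rightarrow> nat"
  view_whiteboard :: "'w whiteboard"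
  view_notebook :: 'm

record ('w, 'm) algorithm =
  initial_memory :: 'w
  initial_notebook :: 'm
  compute :: "('w, 'm) view \<Rightarrow> 'w whiteboard \<times> 'm \<times> move"

text \<open>An instance: a network, a team of agents \<open>0, \<dots>, team_size - 1\<close> with their starting nodes,
  identifiers of nodes and agents, and a scheduler. Under FSYNCH the scheduler only chooses, for
  each round, the order in which all the agents act.\<close>

record 'v scenario =
  net :: "'v network"
  team_size :: nat
  start :: "nat \<Rightarrow> 'v"
  node_id :: "'v \<Rightarrow> nat"
  agent_id :: "nat \<Rightarrow> nat"
  schedule :: "nat \<Rightarrow> nat list"

definition FSYNCH_scenario :: "'v scenario \<Rightarrow> bool" where
  "FSYNCH_scenario S \<longleftrightarrow>
     TRAN_network (net S) \<and>
     (\<forall>a<team_size S. start S a \<in> safe_nodes (net S)) \<and>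
     inj_on (node_id S) (nodes (net S)) \<and>
     inj_on (agent_id S) {..<team_size S} \<and>
     (\<forall>t. distinct (schedule S t) \<and> set (schedule S t) = {..<team_size S})"

definition sufficient_team :: "'v scenario \<Rightarrow> bool" where
  "sufficient_team S \<longleftrightarrow>
     team_size S \<ge>
       2 * card {e \<in> edges (net S). transient (net S) e \<and> \<not> dangerous_edge (net S) e}
       + (\<Sum>b\<in>holes (net S). degree (net S) b) + 1"

record ('v, 'w, 'm) config =
  node_of :: "nat \<Rightarrow> 'v"
  position_of :: "nat \<Rightarrow> position"
  notebook_of :: "nat \<Rightarrow> 'm"
  whiteboard_of :: "'v \<Rightarrow> 'w whiteboard"

definition initial_config ::
    "('w, 'm) algorithm \<Rightarrow> 'v scenario \<Rightarrow> ('v, 'w, 'm) config" where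
  "initial_config A S =
     \<lparr>node_of = start S,
      position_of = (\<lambda>_. Center),
      notebook_of = (\<lambda>_. initial_notebook A),
      whiteboard_of = (\<lambda>_. \<lparr>marks = (\<lambda>_. None), memory = initial_memory A\<rparr>)\<rparr>"

definition view_of ::
    "'v scenario \<Rightarrow> ('v, 'w, 'm) config \<Rightarrow> nat \<Rightarrow> ('w, 'm) view" where
  "view_of S C a =
     (let v = node_of C a in
      \<lparr>view_team_size = team_size S,
       view_num_nodes = card (nodes (net S)),
       view_num_holes = card (holes (net S)),
       view_agent_id = agent_id S a,
       view_node_id = node_id S v,
       view_degree = degree (net S) v,
       view_position = position_of C a,
       view_crowd = (\<lambda>p. card {b. b < team_size S \<and> node_of C b = v \<and> position_of C b = p}),
       view_whiteboard = whiteboard_of C v,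
       view_notebook = notebook_of C a\<rparr>)"

text \<open>A move to a sub-port that does not exist leaves the agent where it is.\<close>

fun apply_move :: "nat \<Rightarrow> move \<Rightarrow> position \<Rightarrow> position" where
  "apply_move d Stay p = p"
| "apply_move d To_Center p = Center"
| "apply_move d (To_Outgoing l) p = (if l < d then Outgoing l else p)"

definition act ::
    "('w, 'm) algorithm \<Rightarrow> 'v scenario \<Rightarrow> nat \<Rightarrow> ('v, 'w, 'm) config \<Rightarrow> ('v, 'w, 'm) config" where
  "act A S a C =
     (let v = node_of C a in
      if v \<in> holes (net S) then C
      else
        (case compute A (view_of S C a) of (wb, nb, m) \<Rightarrow>
           C\<lparr>position_of :=
               (position_of C)(a := apply_move (degree (net S) v) m (position_of C a)),
             notebook_of := (notebook_of C)(a := nb),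
             whiteboard_of := (whiteboard_of C)(v := wb)\<rparr>))"

definition crosses :: "'v scenario \<Rightarrow> nat \<Rightarrow> ('v, 'w, 'm) config \<Rightarrow> nat \<Rightarrow> 'v \<Rightarrow> bool" where
  "crosses S t C a w \<longleftrightarrow>
     (let v = node_of C a in
      w \<in> neighbours (net S) v \<and> position_of C a = Outgoing (port (net S) v w) \<and>
      present (net S) {v, w} t)"

text \<open>In a network the neighbour \<open>w\<close> that an agent crosses to is unique, as the port labelling of
  each node is injective.\<close>

definition cross_edges ::
    "'v scenario \<Rightarrow> nat \<Rightarrow> ('v, 'w, 'm) config \<Rightarrow> ('v, 'w, 'm) config" where
  "cross_edges S t C =
     C\<lparr>node_of :=
         (\<lambda>a. if \<exists>w. crosses S t C a w then (THE w. crosses S t C a w) else node_of C a),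
       position_of :=
         (\<lambda>a. if \<exists>w. crosses S t C a w
              then Ingoing (port (net S) (THE w. crosses S t C a w) (node_of C a))
              else position_of C a)\<rparr>"

fun config_at ::
    "('w, 'm) algorithm \<Rightarrow> 'v scenario \<Rightarrow> nat \<Rightarrow> ('v, 'w, 'm) config" where
  "config_at A S 0 = initial_config A S"
| "config_at A S (Suc t) = cross_edges S t (fold (act A S) (schedule S t) (config_at A S t))"

text \<open>The configuration during round \<open>t\<close>, after the first \<open>i\<close> agents of the schedule have acted.\<close>

definition config_during ::
    "('w, 'm) algorithm \<Rightarrow> 'v scenario \<Rightarrow> nat \<Rightarrow> nat \<Rightarrow> ('v, 'w, 'm) config" where
  "config_during A S t i = fold (act A S) (take i (schedule S t)) (config_at A S t)"

definition free_agents :: "'v scenario \<Rightarrow> ('v, 'w, 'm) config \<Rightarrow> nat set" where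
  "free_agents S C = {a. a < team_size S \<and> node_of C a \<notin> holes (net S)}"

definition visited_at ::
    "('w, 'm) algorithm \<Rightarrow> 'v scenario \<Rightarrow> 'v \<Rightarrow> nat \<Rightarrow> bool" where
  "visited_at A S v t \<longleftrightarrow> (\<exists>a<team_size S. node_of (config_at A S t) a = v)"

text \<open>The agents do nothing in round \<open>t\<close> iff the configuration does not change at any step within
  the round. Comparing only the configurations at the ends of the round would overlook changes
  that one agent makes and another one reverts.\<close>

definition idle_round :: "('w, 'm) algorithm \<Rightarrow> 'v scenario \<Rightarrow> nat \<Rightarrow> bool" where
  "idle_round A S t \<longleftrightarrow>
     (\<forall>i\<le>length (schedule S t). config_during A S t i = config_at A S t)"

definition safe_finite_exploration :: "('w, 'm) algorithm \<Rightarrow> 'v scenario \<Rightarrow> bool" where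
  "safe_finite_exploration A S \<longleftrightarrow>
     (\<exists>T. free_agents S (config_at A S T) \<noteq> {} \<and>
          (\<forall>v\<in>safe_nodes (net S). \<exists>t\<le>T. visited_at A S v t) \<and>
          (\<forall>a\<in>free_agents S (config_at A S T). position_of (config_at A S T) a = Center) \<and>
          (\<forall>t\<ge>T. idle_round A S t))"

definition port_mark ::
    "'v scenario \<Rightarrow> ('v, 'w, 'm) config \<Rightarrow> 'v \<Rightarrow> 'v \<Rightarrow> mark option" where
  "port_mark S C v w = marks (whiteboard_of C v) (port (net S) v w)"

text \<open>The edges of \<open>\<G>\<^sub>S\<^sub>A\<^sub>F\<^sub>E\<close>, whose nodes are the safe nodes.\<close>

definition marked_safe_edges :: "'v scenario \<Rightarrow> ('v, 'w, 'm) config \<Rightarrow> 'v set set" where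
  "marked_safe_edges S C =
     {e \<in> edges (net S). e \<subseteq> safe_nodes (net S) \<and>
        (\<forall>v w. e = {v, w} \<longrightarrow> port_mark S C v w = Some SAFE)}"

definition reliable_port_marking :: "('w, 'm) algorithm \<Rightarrow> 'v scenario \<Rightarrow> bool" where
  "reliable_port_marking A S \<longleftrightarrow>
     (\<exists>T. free_agents S (config_at A S T) \<noteq> {} \<and>
          (\<forall>v\<in>safe_nodes (net S). \<forall>w\<in>neighbours (net S) v.
             dangerous_edge (net S) {v, w} \<longrightarrow>
             port_mark S (config_at A S T) v w = Some DANGEROUS) \<and>
          temporally_connected (safe_nodes (net S))
            (marked_safe_edges S (config_at A S T)) (present (net S)) {} \<and>
          (\<forall>t\<ge>T. \<forall>i. \<forall>v\<in>nodes (net S). \<forall>w\<in>neighbours (net S) v.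
             port_mark S (config_during A S t i) v w = port_mark S (config_at A S T) v w))"

end

theory Submission
  imports Defs
begin

text \<open>Let node \<open>3\<close> be the only black hole. In one network, the edges \<open>{0, 2}\<close>, \<open>{1, 2}\<close> and
  \<open>{2, 3}\<close> are always present, while \<open>{0, 3}\<close> and \<open>{1, 3}\<close> never are. All agents eventually stop,
  at a time \<open>T\<close>, with the ports of the two absent edges marked \<open>DANGEROUS\<close>. In another network, the
  two absent edges are replaced by the single safe edge \<open>{0, 1}\<close>, which uses the same ports of \<open>0\<close>
  and \<open>1\<close>. It is absent before \<open>T\<close> and always present from \<open>T\<close> on, when it takes over from
  \<open>{0, 2}\<close>, which disappears. Up to \<open>T\<close> the agents cannot distinguish the two networks, and nobody
  wakes up after \<open>T\<close>. The port of \<open>{0, 1}\<close> at \<open>0\<close> hence stays marked \<open>DANGEROUS\<close>, although from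
  \<open>T\<close> on this edge is the only one that connects \<open>0\<close> to the rest.\<close>

section \<open>Executions\<close>

lemma act_outgoing_free:
  assumes "a < team_size S"
    and "\<And>b l. position_of C b = Outgoing l \<Longrightarrow> b \<in> free_agents S C"
    and "position_of (act A S a C) b = Outgoing l"
  shows "b \<in> free_agents S (act A S a C)"
  using assms
  by (auto simp: act_def Let_def free_agents_def split: if_splits prod.splits)

lemma fold_act_outgoing_free:
  assumes "set as \<subseteq> {..<team_size S}"
    and "\<And>b l. position_of C b = Outgoing l \<Longrightarrow> b \<in> free_agents S C"
    and "position_of (fold (act A S) as C) b = Outgoing l"
  shows "b \<in> free_agents S (fold (act A S) as C)"
  using assms
proof (induction as arbitrary: C b l)
  case (Cons a as)
  have "b \<in> free_agents S (act A S a C)" if "position_of (act A S a C) b = Outgoing l" for b l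
    using act_outgoing_free[of a S C A b l] Cons.prems(1,2) that by auto
  then show ?case
    using Cons.IH[of "act A S a C" b l] Cons.prems(1,3) by auto
qed auto

text \<open>Safe exploration puts only the free agents at a center, but trapped ones must not be
  about to cross either. Crossing ends at an ingoing sub-port, and an agent in a hole never acts
  again. Numbers outside the team also have positions; they never act and stay at
  \<open>Center\<close>.\<close>

lemma outgoing_free:
  assumes "\<And>t. set (schedule S t) \<subseteq> {..<team_size S}"
    and "position_of (config_at A S t) a = Outgoing l"
  shows "a \<in> free_agents S (config_at A S t)"
  using assms(2)
proof (induction t arbitrary: a l)
  case 0
  then show ?case by (simp add: initial_config_def)
next
  case (Suc t)
  let ?C = "fold (act A S) (schedule S t) (config_at A S t)"
  have "b \<in> free_agents S ?C" if "position_of ?C b = Outgoing l" for b l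
    using fold_act_outgoing_free[OF assms(1) Suc.IH that] .
  then show ?case
    using Suc.prems by (auto simp: cross_edges_def free_agents_def split: if_splits)
qed

lemma cross_edges_no_outgoing:
  assumes "\<And>a l. position_of C a \<noteq> Outgoing l"
  shows "cross_edges S t C = C"
  using assms by (simp add: cross_edges_def crosses_def Let_def)

text \<open>With nobody on an outgoing sub-port, the presence of edges has no effect. Both
  hypotheses can thus be transferred from a network with other edges.\<close>

lemma config_at_constant:
  assumes "\<And>a l. position_of (config_at A S T) a \<noteq> Outgoing l"
    and "\<And>t. t \<ge> T \<Longrightarrow> fold (act A S) (schedule S t) (config_at A S T) = config_at A S T"
    and "t \<ge> T"
  shows "config_at A S t = config_at A S T"
  using assms(3)
  by (induction t rule: dec_induct) (simp_all add: assms(1,2) cross_edges_no_outgoing)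

lemma idle_round_fold_act:
  "idle_round A S t \<Longrightarrow> fold (act A S) (schedule S t) (config_at A S t) = config_at A S t"
  by (auto simp: idle_round_def config_during_def dest: spec[of _ "length (schedule S t)"])

lemma safe_finite_exploration_constant:
  assumes "FSYNCH_scenario S" and "safe_finite_exploration A S"
  obtains T where "\<And>a l. position_of (config_at A S T) a \<noteq> Outgoing l"
    and "\<And>t. t \<ge> T \<Longrightarrow> config_at A S t = config_at A S T"
    and "\<And>t. t \<ge> T \<Longrightarrow> fold (act A S) (schedule S t) (config_at A S T) = config_at A S T"
proof -
  obtain T where
    center: "\<And>a. a \<in> free_agents S (config_at A S T) \<Longrightarrow> position_of (config_at A S T) a = Center"
    and idle: "\<And>t. t \<ge> T \<Longrightarrow> idle_round A S t"
    using assms(2) unfolding safe_finite_exploration_def by blast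
  have "set (schedule S t) \<subseteq> {..<team_size S}" for t
    using assms(1) by (simp add: FSYNCH_scenario_def)
  then have no_outgoing: "position_of (config_at A S T) a \<noteq> Outgoing l" for a l
    using outgoing_free[of S A T a l] center[of a] by auto
  have unchanged: "config_at A S t = config_at A S T" if "t \<ge> T" for t
    using that
  proof (induction t rule: dec_induct)
    case (step t)
    then show ?case
      using idle_round_fold_act[OF idle, of t] no_outgoing by (simp add: cross_edges_no_outgoing)
  qed simp
  show thesis
    using that[OF no_outgoing unchanged] idle_round_fold_act[OF idle] unchanged by metis
qed

text \<open>A view does not reveal which edges exist or are present. Degrees need to agree only
  outside the holes, as a trapped agent computes nothing.\<close>

lemma act_cong:
  assumes "holes (net S) = holes (net S')" and "nodes (net S) = nodes (net S')"
    and "\<And>v. v \<notin> holes (net S) \<Longrightarrow> degree (net S) v = degree (net S') v"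
    and "team_size S = team_size S'" and "node_id S = node_id S'" and "agent_id S = agent_id S'"
  shows "act A S = act A S'"
proof (intro ext)
  fix a and C :: "('a, 'b, 'c) config"
  show "act A S a C = act A S' a C"
    using assms by (simp add: act_def view_of_def Let_def)
qed

lemma cross_edges_cong:
  assumes "port (net S) = port (net S')"
    and "\<And>v w. {v, w} \<in> edges (net S) \<and> present (net S) {v, w} t \<longleftrightarrow>
      {v, w} \<in> edges (net S') \<and> present (net S') {v, w} t"
  shows "cross_edges S t C = cross_edges S' t C"
proof -
  have crosses: "crosses S t C = crosses S' t C"
    using assms by (auto simp: crosses_def neighbours_def Let_def fun_eq_iff)
  show ?thesis
    unfolding cross_edges_def crosses assms(1) ..
qed

section \<open>Journeys along eventually permanent edges\<close>

fun walk :: "'v set set \<Rightarrow> 'v list \<Rightarrow> bool" where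
  "walk E (v # w # xs) \<longleftrightarrow> {v, w} \<in> E \<and> walk E (w # xs)"
| "walk E xs \<longleftrightarrow> True"

lemma journey_Cons:
  assumes "journey E pr (w # xs) js" and "{v, w} \<in> E" and "pr {v, w} s"
    and "\<And>e t. (e, t) \<in> set js \<Longrightarrow> s < t"
  shows "journey E pr (v # w # xs) (({v, w}, s) # js)"
  using assms by (auto simp: journey_def nth_Cons split: nat.splits)

text \<open>From \<open>T\<close> on the edges of \<open>F\<close> never disappear, so the walk can
  take one edge per round, at times \<open>s\<close>, \<open>Suc s\<close> and so on.\<close>

lemma walk_journey:
  assumes "walk F (v # xs)" and "F \<subseteq> E" and "\<And>e t. e \<in> F \<Longrightarrow> t \<ge> T \<Longrightarrow> pr e t" and "T \<le> s"
  shows "\<exists>js. journey E pr (v # xs) js \<and> (\<forall>(e, t)\<in>set js. s \<le> t)"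
  using assms(1,4)
proof (induction xs arbitrary: v s)
  case Nil
  then show ?case by (auto simp: journey_def)
next
  case (Cons w xs)
  obtain js where "journey E pr (w # xs) js" and "\<forall>(e, t)\<in>set js. Suc s \<le> t"
    using Cons.IH[of w "Suc s"] Cons.prems by auto
  moreover from this have "journey E pr (v # w # xs) (({v, w}, s) # js)"
    using Cons.prems assms(2,3) by (intro journey_Cons) auto
  ultimately show ?case
    by (intro exI[of _ "({v, w}, s) # js"]) auto
qed

text \<open>After waiting until time \<open>max t T\<close>, static walks in the eventually
  permanent edges \<open>F\<close> suffice.\<close>

lemma temporally_connectedI:
  assumes "F \<subseteq> E" and "\<And>e t. e \<in> F \<Longrightarrow> t \<ge> T \<Longrightarrow> pr e t"
    and "\<And>v w. v \<in> V \<Longrightarrow> w \<in> V \<Longrightarrow>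
      \<exists>xs. walk F (v # xs) \<and> last (v # xs) = w \<and> set (v # xs) \<inter> B \<subseteq> {v, w}"
  shows "temporally_connected V E pr B"
  unfolding temporally_connected_def
proof (intro ballI allI)
  fix v w t
  assume "v \<in> V" "w \<in> V"
  then obtain xs where
    "walk F (v # xs)" and xs: "last (v # xs) = w" "set (v # xs) \<inter> B \<subseteq> {v, w}"
    using assms(3) by blast
  then obtain js where "journey E pr (v # xs) js" and "\<forall>(e, s)\<in>set js. max t T \<le> s"
    using walk_journey[of F v xs E T pr "max t T"] assms(1,2) by auto
  then show "\<exists>xs js. journey E pr xs js \<and> hd xs = v \<and> last xs = w \<and>
      (\<forall>(e, s)\<in>set js. t \<le> s) \<and> set xs \<inter> B \<subseteq> {v, w}"
    using xs by (intro exI[of _ "v # xs"] exI[of _ js]) auto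
qed

section \<open>The two networks\<close>

text \<open>A single labelling serves both networks: at \<open>0\<close> and \<open>1\<close>, label
  \<open>0\<close> leads to \<open>2\<close> and label \<open>1\<close> to the other neighbour,
  whichever it is. Team size \<open>4\<close> is the required bound in both:
  \<open>0 + 3 + 1\<close> and \<open>2 * 1 + 1 + 1\<close>.\<close>

definition scenario_of :: "nat set set \<Rightarrow> (nat set \<Rightarrow> nat \<Rightarrow> bool) \<Rightarrow> nat scenario" where
  "scenario_of E pr =
     \<lparr>net = \<lparr>nodes = {0, 1, 2, 3}, edges = E, present = pr,
        port = (\<lambda>v w.
          if v = 2 then if w = 3 then 2 else w
          else if w = 2 then 0
          else if v = 3 then Suc w
          else 1),
        holes = {3}\<rparr>,
      team_size = 4,
      start = (\<lambda>_. 2),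
      node_id = id,
      agent_id = id,
      schedule = (\<lambda>_. [0..<4])\<rparr>"

definition star :: "nat set set" where
  "star = {{0, 2}, {1, 2}, {2, 3}}"

definition line :: "nat set set" where
  "line = {{0, 1}, {1, 2}, {2, 3}}"

definition star_scenario :: "nat scenario" where
  "star_scenario = scenario_of (star \<union> {{0, 3}, {1, 3}}) (\<lambda>e t. e \<in> star)"

definition switch_scenario :: "nat \<Rightarrow> nat scenario" where
  "switch_scenario T = scenario_of (star \<union> {{0, 1}}) (\<lambda>e t. e \<in> (if t < T then star else line))"

lemma scenario_of_simps [simp]:
  "nodes (net (scenario_of E pr)) = {0, 1, 2, 3}"
  "edges (net (scenario_of E pr)) = E"
  "present (net (scenario_of E pr)) = pr"
  "holes (net (scenario_of E pr)) = {3}"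
  "team_size (scenario_of E pr) = 4"
  "start (scenario_of E pr) = (\<lambda>_. 2)"
  "node_id (scenario_of E pr) = id"
  "agent_id (scenario_of E pr) = id"
  "schedule (scenario_of E pr) = (\<lambda>_. [0..<4])"
  "safe_nodes (net (scenario_of E pr)) = {0, 1, 2}"
  by (auto simp: scenario_of_def safe_nodes_def)

lemma neighbours_star_scenario:
  "neighbours (net star_scenario) v =
     (if v = 0 \<or> v = 1 then {2, 3} else if v = 2 then {0, 1, 3} else if v = 3 then {0, 1, 2} else {})"
  by (auto simp: star_scenario_def neighbours_def star_def doubleton_eq_iff)

lemma neighbours_switch_scenario:
  "neighbours (net (switch_scenario T)) v =
     (if v = 0 then {1, 2} else if v = 1 then {0, 2} else if v = 2 then {0, 1, 3}
      else if v = 3 then {2} else {})"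
  by (auto simp: switch_scenario_def neighbours_def star_def doubleton_eq_iff)

lemma degree_star_scenario:
  "degree (net star_scenario) v =
     (if v = 0 \<or> v = 1 then 2 else if v = 2 \<or> v = 3 then 3 else 0)"
  by (simp add: degree_def neighbours_star_scenario)

lemma degree_switch_scenario:
  "degree (net (switch_scenario T)) v =
     (if v = 0 \<or> v = 1 then 2 else if v = 2 then 3 else if v = 3 then 1 else 0)"
  by (simp add: degree_def neighbours_switch_scenario)

lemma FSYNCH_star_scenario: "FSYNCH_scenario star_scenario"
proof -
  let ?N = "net star_scenario"
  have "bij_betw (port ?N v) (neighbours ?N v) {..<degree ?N v}" if "v \<in> nodes ?N" for v
    using that unfolding neighbours_star_scenario degree_star_scenario
    by (auto simp: star_scenario_def scenario_of_def bij_betw_def inj_on_def)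
  moreover have "temporally_connected (nodes ?N) (edges ?N) (present ?N) (holes ?N)"
  proof (rule temporally_connectedI[where F = star and T = 0])
    fix v w
    assume "v \<in> nodes ?N" "w \<in> nodes ?N"
    \<comment> \<open>Distinct nodes are joined through the center \<open>2\<close>; the hole is a
      leaf, hence only ever an endpoint.\<close>
    then show "\<exists>xs. walk star (v # xs) \<and> last (v # xs) = w \<and> set (v # xs) \<inter> holes ?N \<subseteq> {v, w}"
      by (intro exI[of _ "if v = w then [] else if v = 2 \<or> w = 2 then [w] else [2, w]"])
        (auto simp: star_scenario_def star_def insert_commute)
  qed (auto simp: star_scenario_def)
  moreover have "finite (nodes ?N)" "holes ?N \<subseteq> nodes ?N" "0 \<in> nodes ?N" "0 \<notin> holes ?N"
    by (simp_all add: star_scenario_def)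
  moreover have "edges ?N \<subseteq> {e. e \<subseteq> nodes ?N \<and> card e = 2}" "\<forall>e\<in>edges ?N. \<not> e \<subseteq> holes ?N"
    by (simp_all add: star_scenario_def star_def)
  ultimately have "TRAN_network ?N"
    unfolding TRAN_network_def by blast
  then show ?thesis
    unfolding FSYNCH_scenario_def by (auto simp: star_scenario_def)
qed

lemma FSYNCH_switch_scenario: "FSYNCH_scenario (switch_scenario T)"
proof -
  let ?N = "net (switch_scenario T)"
  have "bij_betw (port ?N v) (neighbours ?N v) {..<degree ?N v}" if "v \<in> nodes ?N" for v
    using that unfolding neighbours_switch_scenario degree_switch_scenario
    by (auto simp: switch_scenario_def scenario_of_def bij_betw_def inj_on_def)
  moreover have "temporally_connected (nodes ?N) (edges ?N) (present ?N) (holes ?N)"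
  proof (rule temporally_connectedI[where F = line and T = T])
    fix v w
    assume "v \<in> nodes ?N" "w \<in> nodes ?N"
    \<comment> \<open>Along the path 0, 1, 2, 3, the first part of the witness ascends if
      \<open>v < w\<close>, the second descends if \<open>w < v\<close>, and the other part is
      empty. The hole is an end of the path.\<close>
    then show "\<exists>xs. walk line (v # xs) \<and> last (v # xs) = w \<and> set (v # xs) \<inter> holes ?N \<subseteq> {v, w}"
      by (intro exI[of _ "drop (Suc v) (take (Suc w) [0, 1, 2, 3]) @ rev (drop w (take v [0, 1, 2, 3]))"])
        (auto simp: switch_scenario_def line_def insert_commute)
  qed (auto simp: switch_scenario_def line_def star_def)
  moreover have "finite (nodes ?N)" "holes ?N \<subseteq> nodes ?N" "0 \<in> nodes ?N" "0 \<notin> holes ?N"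
    by (simp_all add: switch_scenario_def)
  moreover have "edges ?N \<subseteq> {e. e \<subseteq> nodes ?N \<and> card e = 2}" "\<forall>e\<in>edges ?N. \<not> e \<subseteq> holes ?N"
    by (simp_all add: switch_scenario_def star_def)
  ultimately have "TRAN_network ?N"
    unfolding TRAN_network_def by blast
  then show ?thesis
    unfolding FSYNCH_scenario_def by (auto simp: switch_scenario_def)
qed

lemma sufficient_team_star_scenario: "sufficient_team star_scenario"
proof -
  have no_safe_transient: "{e \<in> edges (net star_scenario). transient (net star_scenario) e \<and>
      \<not> dangerous_edge (net star_scenario) e} = {}"
    by (auto simp: star_scenario_def recurrent_def dangerous_edge_def)
  show ?thesis
    unfolding sufficient_team_def no_safe_transient degree_star_scenario
    by (simp add: star_scenario_def)
qed

lemma sufficient_team_switch_scenario: "sufficient_team (switch_scenario T)"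
proof -
  let ?N = "net (switch_scenario T)"
  have "recurrent ?N e" if "e \<in> line" for e
    unfolding recurrent_def
  proof
    fix t
    have "Suc (T + t) > t" "present ?N e (Suc (T + t))"
      using that by (simp_all add: switch_scenario_def)
    then show "\<exists>t'>t. present ?N e t'"
      by blast
  qed
  moreover have "edges ?N \<subseteq> insert {0, 2} line"
    by (simp add: switch_scenario_def star_def line_def)
  \<comment> \<open>At most the disappearing edge \<open>{0, 2}\<close> counts, which contributes
    \<open>2\<close> to the bound.\<close>
  ultimately have "{e \<in> edges ?N. transient ?N e \<and> \<not> dangerous_edge ?N e} \<subseteq> {{0, 2}}"
    by blast
  then have "card {e \<in> edges ?N. transient ?N e \<and> \<not> dangerous_edge ?N e} \<le> card {{0::nat, 2}}"
    by (rule card_mono[rotated]) simp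
  then show ?thesis
    unfolding sufficient_team_def degree_switch_scenario
    by (simp add: switch_scenario_def)
qed

text \<open>At \<open>0\<close> and \<open>1\<close> the edge \<open>{0, 1}\<close> makes up for the
  lost edge to the hole, so safe nodes keep their degrees. Only the degree of \<open>3\<close>
  differs.\<close>

lemma act_switch_scenario: "act A (switch_scenario T) = act A star_scenario"
  by (rule act_cong) (simp_all add: degree_star_scenario degree_switch_scenario,
      simp_all add: star_scenario_def switch_scenario_def)

text \<open>In the rounds before \<open>T\<close> exactly the edges of \<open>star\<close> are
  present in both. Time \<open>T\<close> is included, as its configuration results from round
  \<open>T - 1\<close> or is initial.\<close>

lemma config_at_switch_scenario_before:
  assumes "t \<le> T"
  shows "config_at A (switch_scenario T) t = config_at A star_scenario t"
  using assms
proof (induction t)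
  case 0
  then show ?case by (simp add: initial_config_def star_scenario_def switch_scenario_def)
next
  case (Suc t)
  have "cross_edges (switch_scenario T) t C = cross_edges star_scenario t C"
    for C :: "(nat, 'a, 'b) config"
  proof (rule cross_edges_cong)
    show "port (net (switch_scenario T)) = port (net star_scenario)"
      by (simp add: star_scenario_def switch_scenario_def scenario_of_def)
  qed (use Suc.prems in \<open>auto simp: star_scenario_def switch_scenario_def\<close>)
  moreover have "schedule (switch_scenario T) = schedule star_scenario"
    by (simp add: star_scenario_def switch_scenario_def)
  ultimately show ?case
    using Suc by (simp add: act_switch_scenario)
qed

lemma switch_scenario_edge_01_marked:
  assumes "temporally_connected (safe_nodes (net (switch_scenario T)))
      (marked_safe_edges (switch_scenario T) C) (present (net (switch_scenario T))) {}"
  shows "port_mark (switch_scenario T) C 0 1 = Some SAFE"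
proof -
  let ?S = "switch_scenario T"
  have "0 \<in> safe_nodes (net ?S)" "1 \<in> safe_nodes (net ?S)"
    by (simp_all add: switch_scenario_def)
  then obtain xs js where js: "journey (marked_safe_edges ?S C) (present (net ?S)) xs js"
    and ends: "hd xs = 0" "last xs = 1" and late: "\<forall>(e, s)\<in>set js. T \<le> s"
    using assms unfolding temporally_connected_def by meson
  have len: "length xs = Suc (length js)"
    using js by (simp add: journey_def)
  have "js \<noteq> []"
  proof
    assume "js = []"
    with len ends show False
      by (cases xs) auto
  qed
  then obtain e s js' where js_eq: "js = (e, s) # js'"
    by (cases js) auto
  have "xs ! 0 = 0"
    using ends(1) len by (cases xs) auto
  \<comment> \<open>A journey from \<open>0\<close> to \<open>1\<close> that starts at a time \<ge>
    \<open>T\<close> must leave \<open>0\<close> by its first edge, and \<open>{0, 1}\<close> is the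
    only edge of \<open>line\<close> at \<open>0\<close>.\<close>
  then have e: "0 \<in> e" "e \<in> marked_safe_edges ?S C" "present (net ?S) e s"
    using js by (auto simp: journey_def js_eq)
  then have "e = {0, 1}"
    using late by (auto simp: js_eq switch_scenario_def line_def)
  with e(2) show ?thesis
    by (auto simp: marked_safe_edges_def)
qed

theorem theorem12:
  shows "\<not> (\<exists>A :: ('w, 'm) algorithm. \<forall>S :: nat scenario.
           FSYNCH_scenario S \<and> sufficient_team S \<longrightarrow>
           safe_finite_exploration A S \<and> reliable_port_marking A S)"
proof
  assume "\<exists>A :: ('w, 'm) algorithm. \<forall>S :: nat scenario.
           FSYNCH_scenario S \<and> sufficient_team S \<longrightarrow>
           safe_finite_exploration A S \<and> reliable_port_marking A S"
  then obtain A :: "('w, 'm) algorithm" where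
    A: "\<And>S :: nat scenario. FSYNCH_scenario S \<Longrightarrow> sufficient_team S \<Longrightarrow>
      safe_finite_exploration A S \<and> reliable_port_marking A S"
    by blast
  have star: "safe_finite_exploration A star_scenario" "reliable_port_marking A star_scenario"
    using A FSYNCH_star_scenario sufficient_team_star_scenario by auto
  obtain T where no_outgoing: "\<And>a l. position_of (config_at A star_scenario T) a \<noteq> Outgoing l"
    and unchanged: "\<And>t. t \<ge> T \<Longrightarrow> config_at A star_scenario t = config_at A star_scenario T"
    and idle: "\<And>t. t \<ge> T \<Longrightarrow> fold (act A star_scenario) (schedule star_scenario t)
      (config_at A star_scenario T) = config_at A star_scenario T"
    by (rule safe_finite_exploration_constant[OF FSYNCH_star_scenario star(1)]) blast
  let ?C = "config_at A star_scenario T" and ?S = "switch_scenario T"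

  obtain T1 where
    dangerous: "\<forall>v\<in>safe_nodes (net star_scenario). \<forall>w\<in>neighbours (net star_scenario) v.
      dangerous_edge (net star_scenario) {v, w} \<longrightarrow>
      port_mark star_scenario (config_at A star_scenario T1) v w = Some DANGEROUS"
    and stable: "\<forall>t\<ge>T1. \<forall>i. \<forall>v\<in>nodes (net star_scenario). \<forall>w\<in>neighbours (net star_scenario) v.
      port_mark star_scenario (config_during A star_scenario t i) v w =
      port_mark star_scenario (config_at A star_scenario T1) v w"
    using star(2) unfolding reliable_port_marking_def by blast
  have edge_03: "0 \<in> safe_nodes (net star_scenario)" "0 \<in> nodes (net star_scenario)"
    "3 \<in> neighbours (net star_scenario) 0" "dangerous_edge (net star_scenario) {0, 3}"
    by (simp_all add: neighbours_star_scenario, simp_all add: star_scenario_def dangerous_edge_def)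
  \<comment> \<open>\<open>T\<close> and \<open>T1\<close> are unrelated: at their maximum the marks
    are final and the configuration is still \<open>?C\<close>. Index \<open>0\<close> is the start
    of the round.\<close>
  have "port_mark star_scenario (config_during A star_scenario (max T T1) 0) 0 3 = Some DANGEROUS"
    using dangerous stable edge_03 max.cobounded2[of T1 T] by metis
  then have "port_mark star_scenario ?C 0 3 = Some DANGEROUS"
    using unchanged[of "max T T1"] by (simp add: config_during_def)
  \<comment> \<open>Marks are stored by label, and label \<open>1\<close> at \<open>0\<close> leads
    to \<open>3\<close> in one network and to \<open>1\<close> in the other.\<close>
  then have marked_dangerous: "port_mark ?S ?C 0 1 = Some DANGEROUS"
    by (simp add: port_mark_def star_scenario_def switch_scenario_def scenario_of_def)

  have "reliable_port_marking A ?S"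
    using A FSYNCH_switch_scenario sufficient_team_switch_scenario by blast
  then obtain T2 where
    connected: "temporally_connected (safe_nodes (net ?S))
      (marked_safe_edges ?S (config_at A ?S T2)) (present (net ?S)) {}"
    and stable': "\<forall>t\<ge>T2. \<forall>i. \<forall>v\<in>nodes (net ?S). \<forall>w\<in>neighbours (net ?S) v.
      port_mark ?S (config_during A ?S t i) v w = port_mark ?S (config_at A ?S T2) v w"
    unfolding reliable_port_marking_def by blast
  have same: "config_at A ?S T = ?C"
    by (simp add: config_at_switch_scenario_before)
  have schedule: "schedule ?S = schedule star_scenario"
    by (simp add: star_scenario_def switch_scenario_def)
  \<comment> \<open>The agents stay idle although the edges change at \<open>T\<close>: acting is
    the same function in both scenarios, and nobody waits to cross.\<close>
  have "config_at A ?S (max T T2) = config_at A ?S T"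
    by (rule config_at_constant) (simp_all add: same no_outgoing act_switch_scenario schedule idle)
  then have "config_during A ?S (max T T2) 0 = ?C"
    by (simp add: config_during_def same)
  moreover have "0 \<in> nodes (net ?S)" "1 \<in> neighbours (net ?S) 0"
    by (simp_all add: neighbours_switch_scenario, simp add: switch_scenario_def)
  ultimately have "port_mark ?S ?C 0 1 = port_mark ?S (config_at A ?S T2) 0 1"
    using stable' max.cobounded2[of T2 T] by metis
  then show False
    using marked_dangerous switch_scenario_edge_01_marked[OF connected] by simp
qed

end
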